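(* If $k\geq 4$ is an integer that is even or not divisible by $3$, then \[ f_2(k)\leq 2k(k+1)(k+2). \]
   Context: An $r$-coloring of a set $A\subseteq\mathbb{N}$ is a function $\Delta:A\to\{0,1,\ldots,r-1\}$. A tuple $(a_1,\ldots,a_k,b)$ of elements of $A$ is a monochromatic solution to an equation $G(x_1,\ldots,x_k,y)=0$ if $G(a_1,\ldots,a_k,b)=0$ and $\Delta(a_1)=\cdots=\Delta(a_k)=\Delta(b)$. For integers $r,k\geq 2$, $f_r(k)$ denotes the smallest positive integer $n$ such that every $r$-coloring of $\{1,2,\ldots,n\}$ has a monochromatic solution to $1/x_1+\cdots+1/x_k=1/y$, where $x_1,\ldots,x_k$ are not necessarily distinct. *)

theory Defs
  imports Complex_Main "HOL-Library.FuncSet" "HOL-Library.Extended_Nat"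
begin

definition coloring :: "nat \<Rightarrow> nat set \<Rightarrow> (nat \<Rightarrow> nat) \<Rightarrow> bool" where
  "coloring r A \<Delta> \<longleftrightarrow> \<Delta> \<in> A \<rightarrow> {0..<r}"

text \<open>An equation in the unknowns \<open>x 1, \<dots>, x k, y\<close> is given by the real-valued function \<open>G\<close>
  whose vanishing it expresses; the tuple \<open>(x 1, \<dots>, x k)\<close> is a function restricted to \<open>{1..k}\<close>.\<close>

definition monochromatic_solution ::
  "nat set \<Rightarrow> (nat \<Rightarrow> nat) \<Rightarrow> nat \<Rightarrow> ((nat \<Rightarrow> nat) \<Rightarrow> nat \<Rightarrow> real) \<Rightarrow> (nat \<Rightarrow> nat) \<Rightarrow> nat \<Rightarrow> bool" where
  "monochromatic_solution A \<Delta> k G x y \<longleftrightarrow>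
     (\<forall>i\<in>{1..k}. x i \<in> A) \<and> y \<in> A \<and> G x y = 0 \<and> (\<forall>i\<in>{1..k}. \<Delta> (x i) = \<Delta> y)"

definition unit_frac_eq :: "nat \<Rightarrow> (nat \<Rightarrow> nat) \<Rightarrow> nat \<Rightarrow> real" where
  "unit_frac_eq k x y = (\<Sum>i=1..k. 1 / real (x i)) - 1 / real y"

definition forces_solution :: "nat \<Rightarrow> nat \<Rightarrow> nat \<Rightarrow> bool" where
  "forces_solution r k n \<longleftrightarrow>
     (\<forall>\<Delta>. coloring r {1..n} \<Delta> \<longrightarrow>
        (\<exists>x y. monochromatic_solution {1..n} \<Delta> k (unit_frac_eq k) x y))"

text \<open>The value lies in \<^typ>\<open>enat\<close>, so that an upper bound on \<open>unit_frac_rado r k\<close> by a natural number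
  includes the existence of a suitable \<open>n\<close>: the infimum of the empty set is \<open>\<infinity>\<close>.\<close>

definition unit_frac_rado :: "nat \<Rightarrow> nat \<Rightarrow> enat" where
  "unit_frac_rado r k = Inf {enat n | n. 1 \<le> n \<and> forces_solution r k n}"

lemma unit_frac_rado_eq_enat_iff:
  "unit_frac_rado r k = enat n \<longleftrightarrow>
     1 \<le> n \<and> forces_solution r k n \<and> (\<forall>m. 1 \<le> m \<and> forces_solution r k m \<longrightarrow> n \<le> m)"
proof
  let ?S = "{enat n | n. 1 \<le> n \<and> forces_solution r k n}"
  assume *: "unit_frac_rado r k = enat n"
  then have "?S \<noteq> {}" unfolding unit_frac_rado_def Inf_enat_def by (metis enat.distinct(1) infinity_enat_def)
  then have "Inf ?S \<in> ?S" unfolding Inf_enat_def using LeastI_ex[of "\<lambda>x. x \<in> ?S"] by auto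
  then have "1 \<le> n \<and> forces_solution r k n" using * by (auto simp: unit_frac_rado_def)
  moreover have "n \<le> m" if "1 \<le> m" "forces_solution r k m" for m
  proof -
    have "Inf ?S \<le> enat m" by (rule Inf_lower) (use that in auto)
    then show ?thesis using * by (simp add: unit_frac_rado_def)
  qed
  ultimately show "1 \<le> n \<and> forces_solution r k n \<and>
    (\<forall>m. 1 \<le> m \<and> forces_solution r k m \<longrightarrow> n \<le> m)" by blast
next
  assume "1 \<le> n \<and> forces_solution r k n \<and> (\<forall>m. 1 \<le> m \<and> forces_solution r k m \<longrightarrow> n \<le> m)"
  then show "unit_frac_rado r k = enat n"
    unfolding unit_frac_rado_def by (intro antisym Inf_lower Inf_greatest) auto
qed

end

theory Submission
  imports Defs
begin

text \<open>
  Substituting \<open>x = M / u\<close> for a divisor \<open>u\<close> of \<open>M\<close> turns \<open>1/x\<^sub>1 + \<dots> + 1/x\<^sub>k = 1/y\<close> into the linear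
  equation \<open>u\<^sub>1 + \<dots> + u\<^sub>k = z\<close> in divisors of \<open>M\<close>. It then suffices to find a few divisors and a
  few solutions among them that no 2-coloring avoids. If \<open>3\<close> does not divide \<open>k\<close>, take
  \<open>M = 2k(k+1)(k+2)\<close> and the divisors \<open>1\<close>, \<open>2\<close>, \<open>3\<close>, \<open>k+2\<close>, \<open>2k\<close>, \<open>3k\<close>, \<open>k(k+2)\<close>, \<open>2k(k+1)\<close>,
  \<open>(k+1)(k+2)\<close>, \<open>2k(k+2)\<close>, \<open>k(k+1)(k+2)\<close>. If \<open>6\<close> divides \<open>k\<close>, take \<open>M = 2k\<^sup>2(k+1)\<close> and the divisors
  \<open>2\<close>, \<open>3\<close>, \<open>4\<close>, \<open>2k\<close>, \<open>3k\<close>, \<open>4k\<close>, \<open>2k\<^sup>2\<close>, \<open>2k(k+1)\<close>.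
\<close>

text \<open>As \<open>1 / a = u / M\<close>, the linear relation is the unit fraction equation
  scaled by \<open>M\<close>. Three values with multiplicities \<open>p\<close>, \<open>q\<close>,
  \<open>r\<close> cover every solution used below.\<close>

lemma monochromatic_solution_of_weights:
  fixes M :: nat
  assumes M: "0 < M" "M \<le> n"
    and pts: "a * u = M" "b * v = M" "c * w = M" "y * z = M"
    and count: "p + q + r = k"
    and lin: "p * u + q * v + r * w = z"
    and col: "\<Delta> a = \<Delta> y" "\<Delta> b = \<Delta> y" "\<Delta> c = \<Delta> y"
  shows "\<exists>x y. monochromatic_solution {1..n} \<Delta> k (unit_frac_eq k) x y"
proof -
  define x where "x i = (if i \<le> p then a else if i \<le> p + q then b else c)" for i
  have recip: "1 / real d = real e / real M" and range: "d \<in> {1..n}" if "d * e = M" for d e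
  proof -
    have "d \<noteq> 0" "e \<noteq> 0" using that M(1) by auto
    then show "1 / real d = real e / real M" using that by (auto simp: field_simps)
    have "d \<le> M" using that \<open>e \<noteq> 0\<close> by auto
    then show "d \<in> {1..n}" using \<open>d \<noteq> 0\<close> M(2) by auto
  qed
  have split: "{1..k} = {1..p} \<union> {p + 1..p + q} \<union> {p + q + 1..p + q + r}"
    using count by auto
  have "(\<Sum>i=1..k. 1 / real (x i)) =
      (\<Sum>i=1..p. 1 / real (x i)) + (\<Sum>i=p+1..p+q. 1 / real (x i))
        + (\<Sum>i=p+q+1..p+q+r. 1 / real (x i))"
    unfolding split by (subst sum.union_disjoint; auto)+
  also have "\<dots> = p * (1 / real a) + q * (1 / real b) + r * (1 / real c)"
    by (simp add: x_def)
  also have "\<dots> = real (p * u + q * v + r * w) / real M"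
    unfolding recip[OF pts(1)] recip[OF pts(2)] recip[OF pts(3)] by (simp add: add_divide_distrib)
  also have "\<dots> = 1 / real y"
    unfolding lin recip[OF pts(4)] ..
  finally have "unit_frac_eq k x y = 0"
    by (simp add: unit_frac_eq_def)
  moreover have "x i \<in> {1..n}" "\<Delta> (x i) = \<Delta> y" for i
    using range pts col by (auto simp: x_def)
  ultimately show ?thesis
    using range[OF pts(4)] unfolding monochromatic_solution_def by blast
qed

text \<open>Divisors \<open>d\<close> inherit the colour of \<open>M div d\<close>. With two
  colours, whether that colour is \<open>0\<close> determines it, so a predicate \<open>F\<close>
  records everything and the problem becomes propositional.\<close>

lemma forces_solution_of_weights:
  fixes M :: nat
  assumes M: "0 < M" "M \<le> n"
    and unavoidable: "\<And>F :: nat \<Rightarrow> bool.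
      (\<And>p q r u v w z. \<lbrakk>u dvd M; v dvd M; w dvd M; z dvd M; p + q + r = k; p * u + q * v + r * w = z\<rbrakk>
        \<Longrightarrow> \<not> (F u = F z \<and> F v = F z \<and> F w = F z)) \<Longrightarrow> False"
  shows "forces_solution 2 k n"
  unfolding forces_solution_def
proof (intro allI impI, rule ccontr)
  fix \<Delta>
  assume col: "coloring 2 {1..n} \<Delta>"
    and none: "\<nexists>x y. monochromatic_solution {1..n} \<Delta> k (unit_frac_eq k) x y"
  have two: "\<Delta> (M div d) < 2" if "d dvd M" for d
  proof -
    have "M div d \<noteq> 0" using that M(1) by (simp add: dvd_div_eq_0_iff)
    moreover have "M div d \<le> n" using M(2) div_le_dividend le_trans by blast
    ultimately have "M div d \<in> {1..n}" by auto
    then show ?thesis using col by (auto simp: coloring_def)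
  qed
  have same: "\<Delta> (M div d) = \<Delta> (M div e)"
    if "(\<Delta> (M div d) = 0) = (\<Delta> (M div e) = 0)" "d dvd M" "e dvd M" for d e
    using that two[of d] two[of e] by linarith
  show False
  proof (rule unavoidable[of "\<lambda>u. \<Delta> (M div u) = 0"], rule notI)
    fix p q r u v w z
    assume dvd: "u dvd M" "v dvd M" "w dvd M" "z dvd M"
      and lin: "p + q + r = k" "p * u + q * v + r * w = z"
      and eq: "(\<Delta> (M div u) = 0) = (\<Delta> (M div z) = 0) \<and> (\<Delta> (M div v) = 0) = (\<Delta> (M div z) = 0)
        \<and> (\<Delta> (M div w) = 0) = (\<Delta> (M div z) = 0)"
    have "\<Delta> (M div u) = \<Delta> (M div z)" "\<Delta> (M div v) = \<Delta> (M div z)" "\<Delta> (M div w) = \<Delta> (M div z)"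
      using eq same dvd by auto
    then show False
      using none monochromatic_solution_of_weights[OF M dvd[THEN dvd_div_mult_self] lin] by blast
  qed
qed

lemma forces_solution_not_3_dvd:
  fixes k :: nat
  assumes "k \<ge> 4" and "\<not> 3 dvd k"
  shows "forces_solution 2 k (2 * k * (k + 1) * (k + 2))"
proof (rule forces_solution_of_weights)
  let ?N = "2 * k * (k + 1) * (k + 2)"
  show "0 < ?N" using assms(1) by simp
  show "?N \<le> ?N" ..
  fix F :: "nat \<Rightarrow> bool"
  assume avoid: "\<lbrakk>u dvd ?N; v dvd ?N; w dvd ?N; z dvd ?N; p + q + r = k; p * u + q * v + r * w = z\<rbrakk>
    \<Longrightarrow> \<not> (F u = F z \<and> F v = F z \<and> F w = F z)" for p q r u v w z
  \<comment> \<open>Multiplicities such as \<open>k - 4\<close> become \<open>h\<close>, free of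
    truncated subtraction.\<close>
  obtain h where k: "k = h + 4" using assms(1) by (metis le_add_diff_inverse2)
  \<comment> \<open>The factor \<open>3\<close> found here makes both \<open>3\<close> and
    \<open>3 * k\<close> divisors of \<open>?N\<close>.\<close>
  have "3 dvd k + 1 \<or> 3 dvd k + 2" using assms(2) by presburger
  then obtain t where t: "(k + 1) * (k + 2) = 3 * t" by (metis dvd_def dvd_mult dvd_mult2)
  have N: "?N = 2 * k * (3 * t)" by (simp only: mult.assoc t)
  have "?N = 1 * ?N" "?N = 2 * (k * (k + 1) * (k + 2))"
    "?N = (k + 2) * (2 * k * (k + 1))" "?N = (2 * k) * ((k + 1) * (k + 2))"
    "?N = (k * (k + 2)) * (2 * (k + 1))" "?N = (2 * k * (k + 2)) * (k + 1)"
    "?N = ((k + 1) * (k + 2)) * (2 * k)" "?N = (2 * k * (k + 1)) * (k + 2)"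
    "?N = (k * (k + 1) * (k + 2)) * 2"
    by (simp_all only: mult_1 mult_ac)
  moreover have "?N = 3 * (2 * k * t)" "?N = (3 * k) * (2 * t)"
    unfolding N by (simp_all only: mult_ac)
  ultimately have d: "1 dvd ?N" "2 dvd ?N" "3 dvd ?N" "k + 2 dvd ?N" "2 * k dvd ?N" "3 * k dvd ?N"
    "k * (k + 2) dvd ?N" "2 * k * (k + 2) dvd ?N" "(k + 1) * (k + 2) dvd ?N"
    "2 * k * (k + 1) dvd ?N" "k * (k + 1) * (k + 2) dvd ?N"
    by (metis dvdI)+
  \<comment> \<open>A summand slot of multiplicity \<open>0\<close> repeats a divisor already in
    use, so it adds no colour condition.\<close>
  have "\<not> (F 1 = F (k + 2) \<and> F 3 = F (k + 2))"
    using avoid[OF d(1,3,3,4), of "h + 3" 1 0] k by simp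
  moreover have "\<not> (F 1 = F ((k + 1) * (k + 2)) \<and> F 2 = F ((k + 1) * (k + 2))
      \<and> F (k * (k + 2)) = F ((k + 1) * (k + 2)))"
    using avoid[OF d(1,2,7,9), of h 3 1] k by (simp add: algebra_simps)
  moreover have "F 2 \<noteq> F (2 * k)"
    using avoid[OF d(2,2,2,5), of k 0 0] by simp
  moreover have "\<not> (F 2 = F (3 * k) \<and> F (k + 2) = F (3 * k))"
    using avoid[OF d(2,4,4,6), of "h + 3" 1 0] k by (simp add: algebra_simps)
  moreover have "\<not> (F 2 = F (2 * k * (k + 2)) \<and> F 3 = F (2 * k * (k + 2))
      \<and> F (2 * k * (k + 1)) = F (2 * k * (k + 2)))"
    using avoid[OF d(2,3,10,8), of "h + 1" 2 1] k by (simp add: algebra_simps)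
  moreover have "F 3 \<noteq> F (3 * k)"
    using avoid[OF d(3,3,3,6), of k 0 0] by simp
  moreover have "F (k + 2) \<noteq> F (k * (k + 2))"
    using avoid[OF d(4,4,4,7), of k 0 0] by simp
  moreover have "\<not> (F (k + 2) = F (2 * k * (k + 2)) \<and> F ((k + 1) * (k + 2)) = F (2 * k * (k + 2)))"
    using avoid[OF d(4,9,9,8), of "h + 3" 1 0] k by (simp add: algebra_simps)
  moreover have "\<not> (F (2 * k) = F (2 * k * (k + 1)) \<and> F (3 * k) = F (2 * k * (k + 1)))"
    using avoid[OF d(5,6,6,10), of "h + 2" 2 0] k by (simp add: algebra_simps)
  moreover have "\<not> (F (2 * k) = F (2 * k * (k + 2)) \<and> F (3 * k) = F (2 * k * (k + 2)))"
    using avoid[OF d(5,6,6,8), of h 4 0] k by (simp add: algebra_simps)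
  moreover have "\<not> (F (k * (k + 2)) = F (k * (k + 1) * (k + 2))
      \<and> F (2 * k * (k + 2)) = F (k * (k + 1) * (k + 2)))"
    using avoid[OF d(7,8,8,11), of "h + 3" 1 0] k by (simp add: algebra_simps)
  moreover have "F ((k + 1) * (k + 2)) \<noteq> F (k * (k + 1) * (k + 2))"
    using avoid[OF d(9,9,9,11), of k 0 0] by (simp add: algebra_simps)
  \<comment> \<open>Call the colour of \<open>2\<close> red, the other blue. If \<open>3\<close> is
    red, then \<open>2 * k\<close> and \<open>3 * k\<close> are blue, so
    \<open>2 * k * (k + 1)\<close> and \<open>2 * k * (k + 2)\<close> are red, a red solution with
    \<open>2\<close> and \<open>3\<close>. If \<open>3\<close> is blue, then \<open>3 * k\<close> is
    red, \<open>k + 2\<close> blue, \<open>k * (k + 2)\<close> and \<open>1\<close> red,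
    \<open>(k + 1) * (k + 2)\<close> blue, hence \<open>2 * k * (k + 2)\<close> and
    \<open>k * (k + 1) * (k + 2)\<close> red, which with \<open>k * (k + 2)\<close> form a red
    solution.\<close>
  ultimately show False by argo
qed

text \<open>Now \<open>3 * k\<close> does not divide \<open>2 * k * (k + 1) * (k + 2)\<close>.
  Replacing \<open>k + 2\<close> by \<open>k\<close> keeps \<open>M\<close> below the bound and
  makes \<open>3 * k\<close> and \<open>4 * k\<close> divisors.\<close>

lemma forces_solution_6_dvd:
  fixes k :: nat
  assumes "k > 0" and "6 dvd k"
  shows "forces_solution 2 k (2 * k * (k + 1) * (k + 2))"
proof (rule forces_solution_of_weights)
  let ?M = "2 * k * k * (k + 1)"
  show "0 < ?M" using assms(1) by simp
  show "?M \<le> 2 * k * (k + 1) * (k + 2)" by (simp add: algebra_simps)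
  fix F :: "nat \<Rightarrow> bool"
  assume avoid: "\<lbrakk>u dvd ?M; v dvd ?M; w dvd ?M; z dvd ?M; p + q + r = k; p * u + q * v + r * w = z\<rbrakk>
    \<Longrightarrow> \<not> (F u = F z \<and> F v = F z \<and> F w = F z)" for p q r u v w z
  obtain m where "k = 6 * m" using assms(2) by (rule dvdE)
  \<comment> \<open>Some relations split the summands into halves: \<open>3 * j + 3\<close> is
    \<open>k / 2\<close>.\<close>
  with assms(1) obtain j where k: "k = 6 * j + 6" by (cases m) auto
  define g where "g = j + 1"
  have g: "k = 6 * g" by (simp add: k g_def)
  have "?M = 2 * (k * k * (k + 1))" "?M = 3 * (4 * g * k * (k + 1))" "?M = 4 * (3 * g * k * (k + 1))"
    "?M = (2 * k) * (k * (k + 1))" "?M = (3 * k) * (4 * g * (k + 1))" "?M = (4 * k) * (3 * g * (k + 1))"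
    "?M = (2 * k * k) * (k + 1)" "?M = (2 * k * (k + 1)) * k"
    by (simp_all add: g algebra_simps)
  note d = this[THEN dvdI]
  have "F 2 \<noteq> F (2 * k)"
    using avoid[OF d(1,1,1,4), of k 0 0] by simp
  moreover have "F 3 \<noteq> F (3 * k)"
    using avoid[OF d(2,2,2,5), of k 0 0] by simp
  moreover have "F 4 \<noteq> F (4 * k)"
    using avoid[OF d(3,3,3,6), of k 0 0] by simp
  moreover have "F (2 * k) \<noteq> F (2 * k * k)"
    using avoid[OF d(4,4,4,7), of k 0 0] by (simp add: algebra_simps)
  moreover have "\<not> (F 2 = F (3 * k) \<and> F 4 = F (3 * k))"
    using avoid[OF d(1,3,3,5), of "3 * j + 3" "3 * j + 3" 0] k by simp
  moreover have "\<not> (F 2 = F (2 * k * (k + 1)) \<and> F 3 = F (2 * k * (k + 1))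
      \<and> F (2 * k * k) = F (2 * k * (k + 1)))"
    using avoid[OF d(1,2,7,8), of "6 * j + 3" 2 1] k by (simp add: algebra_simps)
  moreover have "\<not> (F 2 = F (2 * k * k) \<and> F (4 * k) = F (2 * k * k) \<and> F (3 * k) = F (2 * k * k))"
    using avoid[OF d(1,6,5,7), of "3 * j + 3" "3 * j + 2" 1] k by (simp add: algebra_simps)
  moreover have "\<not> (F (2 * k) = F (2 * k * (k + 1)) \<and> F (3 * k) = F (2 * k * (k + 1)))"
    using avoid[OF d(4,5,5,8), of "6 * j + 4" 2 0] k by (simp add: algebra_simps)
  \<comment> \<open>With \<open>2\<close> red, \<open>2 * k\<close> is blue and
    \<open>2 * k * k\<close> red. If \<open>3\<close> is red, \<open>3 * k\<close> is blue, so
    \<open>2 * k * (k + 1)\<close> is red and closes a red solution. If \<open>3\<close> is blue,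
    \<open>3 * k\<close> is red, \<open>4\<close> blue and \<open>4 * k\<close> red, so
    \<open>2\<close>, \<open>4 * k\<close>, \<open>3 * k\<close>, \<open>2 * k * k\<close> are all
    red.\<close>
  ultimately show False by argo
qed

theorem theorem3p3:
  fixes k :: nat
  assumes "k \<ge> 4" and "even k \<or> \<not> 3 dvd k"
  shows "unit_frac_rado 2 k \<le> enat (2 * k * (k + 1) * (k + 2))"
proof -
  have "6 dvd k \<or> \<not> 3 dvd k" using assms(2) by presburger
  then have "forces_solution 2 k (2 * k * (k + 1) * (k + 2))"
    using forces_solution_not_3_dvd forces_solution_6_dvd assms(1) by auto
  moreover have "1 \<le> 2 * k * (k + 1) * (k + 2)"
    using assms(1) by simp
  ultimately show ?thesis
    unfolding unit_frac_rado_def by (intro Inf_lower) blast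
qed

end
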